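(* Let $r>0$ be an integer and $\underline{x}=(x_2,\ldots,x_r)$ a tuple of elements of $\{0,1\}$. Any $\Phi$-irreducible element $w$ of $\Gamma_{\underline{x}}$ is $W$-conjugate to a $\Phi$-irreducible element of $\Gamma_{(0,\ldots,0)}$ (for the same $r$).
   Context: Let $T$ be the infinite rooted regular binary tree whose vertices are the finite words over $\{0,1\}$, with root the empty word, each word $t$ being joined by an edge to the words $0t$ and $1t$. Let $W=\mathrm{Aut}(T)$ be the automorphism group of $T$ (products are compositions, $(uv)(t)=u(v(t))$), with identity element $1$. For $u,v\in W$, let $(u,v)\in W$ be the automorphism fixing the root and given by $t0\mapsto u(t)0$ and $t1\mapsto v(t)1$ for every word $t$. Let $\sigma\in W$ be the involution fixing the root with $t0\mapsto t1$ and $t1\mapsto t0$ for every word $t$. Then $W=(W\times W)\rtimes\langle\sigma\rangle$, so every $w\in W$ can be written uniquely as $(u,v)$ or as $(u,v)\,\sigma$. The first descendants of $w\in W$ are the elements $u$ and $v$ if $w=(u,v)$, respectively the single element $uv$ if $w=(u,v)\,\sigma$. For $n\ge1$, the first descendants of the $n$-th descendants of $w$ are the $(n+1)$-st descendants of $w$. $\mathrm{Desc}(w)$ is the set of all $n$-th descendants of $w$ for all $n\ge1$. An element $w$ is called $\Phi$-irreducible if $\mathrm{Desc}(w)$ is finite and $w\in\mathrm{Desc}(w)$. For any tuple $\underline{x}=(x_2,\ldots,x_r)$ of elements of $\{0,1\}$, let $b_1,\ldots,b_r\in W$ be the elements determined by the recursion relations $b_1=(1,b_r)\,\sigma$; $b_i=(b_{i-1},1)$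 for all $2\le i\le r$ with $x_i=0$; $b_i=(1,b_{i-1})$ for all $2\le i\le r$ with $x_i=1$. Let $\Gamma_{\underline{x}}\subset W$ be the subgroup generated by $b_1,\ldots,b_r$. *)

theory Defs
  imports "HOL-Algebra.Generated_Groups"
begin

text \<open>
  The letters 0 and 1 are \<^const>\<open>False\<close> and \<^const>\<open>True\<close>. A vertex of the tree is the list of
  letters read off along the path from the root, so a word written from left to right, in which
  children are obtained by prepending a letter, is stored from right to left: the word \<open>t0\<close> is
  the list \<open>False # t\<close>, and the children of \<open>t\<close> are the lists \<open>t @ [d]\<close>.
\<close>

type_synonym vertex = "bool list"

definition adjacent :: "vertex \<Rightarrow> vertex \<Rightarrow> bool" where
  "adjacent s t \<longleftrightarrow> (\<exists>d. t = s @ [d]) \<or> (\<exists>d. s = t @ [d])"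

definition AutT :: "(vertex \<Rightarrow> vertex) monoid" where
  "AutT = \<lparr>carrier = {f. bij f \<and> f [] = [] \<and> (\<forall>s t. adjacent (f s) (f t) \<longleftrightarrow> adjacent s t)},
           mult = (\<circ>), one = id\<rparr>"

primrec pair :: "(vertex \<Rightarrow> vertex) \<Rightarrow> (vertex \<Rightarrow> vertex) \<Rightarrow> vertex \<Rightarrow> vertex" where
  "pair u v [] = []"
| "pair u v (d # t) = d # (if d then v t else u t)"

primrec swap :: "vertex \<Rightarrow> vertex" where
  "swap [] = []"
| "swap (d # t) = (\<not> d) # t"

definition first_descendants :: "(vertex \<Rightarrow> vertex) \<Rightarrow> (vertex \<Rightarrow> vertex) set" where
  "first_descendants w =
     {d. \<exists>u\<in>carrier AutT. \<exists>v\<in>carrier AutT.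
           (w = pair u v \<and> (d = u \<or> d = v)) \<or> (w = pair u v \<circ> swap \<and> d = u \<circ> v)}"

primrec nth_descendants :: "nat \<Rightarrow> (vertex \<Rightarrow> vertex) \<Rightarrow> (vertex \<Rightarrow> vertex) set" where
  "nth_descendants 0 w = {w}"
| "nth_descendants (Suc n) w = (\<Union>v\<in>nth_descendants n w. first_descendants v)"

definition Desc :: "(vertex \<Rightarrow> vertex) \<Rightarrow> (vertex \<Rightarrow> vertex) set" where
  "Desc w = (\<Union>n\<in>{1..}. nth_descendants n w)"

definition Phi_irreducible :: "(vertex \<Rightarrow> vertex) \<Rightarrow> bool" where
  "Phi_irreducible w \<longleftrightarrow> finite (Desc w) \<and> w \<in> Desc w"

text \<open>
  \<open>gen r x i\<close> is the generator \<open>b\<^sub>i\<close>. A tuple \<open>(x\<^sub>2, \<dots>, x\<^sub>r)\<close> is given by a function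
  \<open>x\<close> on indices; only its values at \<open>2, \<dots>, r\<close> matter (\<open>gen_cong\<close> below). The elements are
  constructed by recursion on the vertex; \<open>gen_recursion\<close> and \<open>gen_unique\<close> below show
  that they are exactly the solution of the defining recursion relations.
\<close>

fun gen :: "nat \<Rightarrow> (nat \<Rightarrow> bool) \<Rightarrow> nat \<Rightarrow> vertex \<Rightarrow> vertex" where
  "gen r x i [] = []"
| "gen r x i (d # t) =
     (if i \<le> 1 then (if d then False # t else True # gen r x r t)
      else if d = x i then d # gen r x (i - 1) t else d # t)"

definition Gamma :: "nat \<Rightarrow> (nat \<Rightarrow> bool) \<Rightarrow> (vertex \<Rightarrow> vertex) set" where
  "Gamma r x = generate AutT (gen r x ` {1..r})"

lemma AutT_simps [simp]: "mult AutT = (\<circ>)" "one AutT = id"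
  by (simp_all add: AutT_def)

lemma AutT_snoc:
  assumes "f \<in> carrier AutT"
  shows "\<exists>e. f (s @ [d]) = f s @ [e]"
proof -
  have bij: "bij f" and adj: "\<And>s t. adjacent (f s) (f t) \<longleftrightarrow> adjacent s t" and nil: "f [] = []"
    using assms by (auto simp: AutT_def)
  have *: "(\<exists>e. f (s @ [d]) = f s @ [e]) \<or> (\<exists>e. f s = f (s @ [d]) @ [e])" for s d
    using adj[of s "s @ [d]"] unfolding adjacent_def by blast
  show ?thesis
  proof (induction s arbitrary: d rule: rev_induct)
    case Nil
    then show ?case using *[of "[]" d] nil by auto
  next
    case (snoc a s)
    obtain e where e: "f (s @ [a]) = f s @ [e]" using snoc by blast
    have False if "f (s @ [a]) = f ((s @ [a]) @ [d]) @ [e']" for e'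
    proof -
      have "f ((s @ [a]) @ [d]) = f s" using that e by simp
      then have "(s @ [a]) @ [d] = s" using bij by (meson bij_def injD)
      then show False by simp
    qed
    then show ?case using *[of "s @ [a]" d] by blast
  qed
qed

lemma AutT_iff:
  "f \<in> carrier AutT \<longleftrightarrow> bij f \<and> f [] = [] \<and> (\<forall>s d. \<exists>e. f (s @ [d]) = f s @ [e])"
proof
  assume "f \<in> carrier AutT"
  then show "bij f \<and> f [] = [] \<and> (\<forall>s d. \<exists>e. f (s @ [d]) = f s @ [e])"
    using AutT_snoc[of f] by (auto simp: AutT_def)
next
  assume R: "bij f \<and> f [] = [] \<and> (\<forall>s d. \<exists>e. f (s @ [d]) = f s @ [e])"
  have *: "\<exists>d. t = s @ [d]" if ft: "f t = f s @ [d]" for s t d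
  proof (cases t rule: rev_cases)
    case Nil
    then show ?thesis using ft R by simp
  next
    case (snoc t' e)
    obtain e' where "f t = f t' @ [e']" using R snoc by blast
    then have "f t' = f s" using ft by simp
    then have "t' = s" using R by (meson bij_def injD)
    then show ?thesis using snoc by blast
  qed
  have "adjacent (f s) (f t) \<longleftrightarrow> adjacent s t" for s t
    unfolding adjacent_def using * R by metis
  then show "f \<in> carrier AutT" using R by (simp add: AutT_def)
qed

lemma group_AutT: "group AutT"
proof (rule groupI)
  show "f \<otimes>\<^bsub>AutT\<^esub> g \<in> carrier AutT" if "f \<in> carrier AutT" "g \<in> carrier AutT" for f g
    using that by (auto simp: AutT_def intro: bij_comp)
  show "\<one>\<^bsub>AutT\<^esub> \<in> carrier AutT" by (simp add: AutT_def)
  show "\<exists>g\<in>carrier AutT. g \<otimes>\<^bsub>AutT\<^esub> f = \<one>\<^bsub>AutT\<^esub>" if "f \<in> carrier AutT" for f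
  proof (intro bexI)
    have bij: "bij f" and nil: "f [] = []"
      and adj: "\<And>s t. adjacent (f s) (f t) \<longleftrightarrow> adjacent s t"
      using that by (auto simp: AutT_def)
    have ff: "f (inv_into UNIV f y) = y" for y using bij by (simp add: bij_is_surj surj_f_inv_f)
    show "inv_into UNIV f \<otimes>\<^bsub>AutT\<^esub> f = \<one>\<^bsub>AutT\<^esub>" using bij by (simp add: bij_is_inj)
    have "inv_into UNIV f [] = []" using bij nil by (metis bij_inv_eq_iff)
    moreover have "adjacent (inv_into UNIV f s) (inv_into UNIV f t) \<longleftrightarrow> adjacent s t" for s t
      using adj[of "inv_into UNIV f s" "inv_into UNIV f t"] by (simp add: ff)
    ultimately show "inv_into UNIV f \<in> carrier AutT"
      using bij by (simp add: AutT_def bij_imp_bij_inv)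
  qed
qed (simp_all add: comp_assoc)

lemma pair_in_AutT:
  assumes u: "u \<in> carrier AutT" and v: "v \<in> carrier AutT"
  shows "pair u v \<in> carrier AutT"
  unfolding AutT_iff
proof (intro conjI allI)
  have bij: "bij u" "bij v" and nil: "u [] = []" "v [] = []"
    and sn: "\<And>s d. \<exists>e. u (s @ [d]) = u s @ [e]" "\<And>s d. \<exists>e. v (s @ [d]) = v s @ [e]"
    using u v by (auto simp: AutT_iff)
  have "inj (pair u v)"
  proof (rule injI)
    fix s t assume "pair u v s = pair u v t"
    then show "s = t" using bij by (cases s; cases t) (auto split: if_splits dest: bij_is_inj injD)
  qed
  moreover have "\<exists>s. y = pair u v s" for y
  proof (cases y)
    case Nil
    then have "y = pair u v []" by simp
    then show ?thesis by blast
  next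
    case (Cons d t)
    then have "y = pair u v (d # inv_into UNIV (if d then v else u) t)"
      using bij by (simp add: bij_is_surj surj_f_inv_f)
    then show ?thesis by blast
  qed
  ultimately show "bij (pair u v)" by (auto simp: bij_def surj_def)
  show "pair u v [] = []" by simp
  show "\<exists>e. pair u v (s @ [d]) = pair u v s @ [e]" for s d
    by (cases s) (use sn nil in auto)
qed

lemma swap_swap [simp]: "swap (swap t) = t"
  by (cases t) auto

lemma swap_in_AutT: "swap \<in> carrier AutT"
proof -
  have "\<exists>e. swap (s @ [d]) = swap s @ [e]" for s d by (cases s) auto
  moreover have "bij swap" by (rule o_bij[of swap]) auto
  ultimately show ?thesis by (simp add: AutT_iff)
qed

lemma AutT_pair_cases:
  assumes "w \<in> carrier AutT"
  obtains u v where "u \<in> carrier AutT" "v \<in> carrier AutT" "w = pair u v"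
  | u v where "u \<in> carrier AutT" "v \<in> carrier AutT" "w = pair u v \<circ> swap"
proof -
  have split: "\<exists>u\<in>carrier AutT. \<exists>v\<in>carrier AutT. f = pair u v"
    if f: "f \<in> carrier AutT" and f0: "f [False] = [False]" for f
  proof -
    have bij: "bij f" and nil: "f [] = []" and sn: "\<And>s d. \<exists>e. f (s @ [d]) = f s @ [e]"
      using f by (auto simp: AutT_iff)
    have f1: "f [True] = [True]"
    proof -
      obtain e where e: "f [True] = [e]" using sn[of "[]" True] nil by auto
      have "f [True] \<noteq> f [False]" using bij by (metis bij_def injD list.inject)
      then show ?thesis using e f0 by (cases e) auto
    qed
    define u where "u d t = tl (f (d # t))" for d t
    have fu: "f (d # t) = d # u d t" for d t
    proof (induction t rule: rev_induct)
      case Nil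
      then show ?case using f0 f1 by (cases d) (auto simp: u_def)
    next
      case (snoc a t)
      obtain e where "f ((d # t) @ [a]) = f (d # t) @ [e]" using sn by blast
      then have "f (d # (t @ [a])) = d # (u d t @ [e])" using snoc by simp
      then show ?case by (simp add: u_def)
    qed
    have "u d \<in> carrier AutT" for d
      unfolding AutT_iff
    proof (intro conjI allI)
      have "inj (u d)"
      proof (rule injI)
        fix s t assume "u d s = u d t"
        then have "f (d # s) = f (d # t)" by (simp add: fu)
        then show "s = t" using bij by (metis bij_def injD list.inject)
      qed
      moreover have "\<exists>t. y = u d t" for y
      proof -
        obtain z where z: "f z = d # y" using bij by (metis bij_pointE)
        then obtain d' t where "z = d' # t" using nil by (cases z) auto
        then show ?thesis using z fu by auto
      qed
      ultimately show "bij (u d)" by (auto simp: bij_def surj_def)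
      show "u d [] = []" using f0 f1 by (cases d) (auto simp: u_def)
      show "\<exists>e. u d (s @ [a]) = u d s @ [e]" for s a
        using sn[of "d # s" a] by (auto simp: fu)
    qed
    moreover have "f = pair (u False) (u True)"
    proof
      fix t show "f t = pair (u False) (u True) t" by (cases t) (auto simp: nil fu)
    qed
    ultimately show ?thesis by blast
  qed
  obtain e where e: "w [False] = [e]"
    using assms AutT_snoc[OF assms, of "[]" False] by (auto simp: AutT_iff)
  show ?thesis
  proof (cases e)
    case False
    then show ?thesis using split[OF assms] e that(1) by auto
  next
    case True
    obtain e' where e': "w [True] = [e']"
      using assms AutT_snoc[OF assms, of "[]" True] by (auto simp: AutT_iff)
    have "w [True] \<noteq> w [False]" using assms by (metis AutT_iff bij_def injD list.inject)
    then have "(w \<circ> swap) [False] = [False]" using True e e' by simp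
    moreover have "w \<circ> swap \<in> carrier AutT"
      using group.is_monoid[OF group_AutT] monoid.m_closed[of AutT w swap] assms swap_in_AutT
      by simp
    ultimately obtain u v where uv: "u \<in> carrier AutT" "v \<in> carrier AutT" "w \<circ> swap = pair u v"
      using split by blast
    have "w = pair u v \<circ> swap"
      by (simp add: uv(3)[symmetric] fun_eq_iff)
    then show ?thesis using uv that(2) by blast
  qed
qed

lemma pair_eq_iff: "pair u v = pair u' v' \<longleftrightarrow> u = u' \<and> v = v'"
proof
  assume eq: "pair u v = pair u' v'"
  have "u t = u' t \<and> v t = v' t" for t
    using fun_cong[OF eq, of "False # t"] fun_cong[OF eq, of "True # t"] by simp
  then show "u = u' \<and> v = v'" by auto
qed simp

lemma pair_swap_eq_iff: "pair u v \<circ> swap = pair u' v' \<circ> swap \<longleftrightarrow> u = u' \<and> v = v'"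
proof
  assume eq: "pair u v \<circ> swap = pair u' v' \<circ> swap"
  have "pair u v t = pair u' v' t" for t
    using fun_cong[OF eq, of "swap t"] by simp
  then show "u = u' \<and> v = v'" by (metis ext pair_eq_iff)
qed simp

lemma pair_neq_pair_swap: "pair u v \<noteq> pair u' v' \<circ> swap"
proof
  assume "pair u v = pair u' v' \<circ> swap"
  from fun_cong[OF this, of "[False]"] show False by simp
qed

lemma first_descendants_pair:
  assumes "u \<in> carrier AutT" "v \<in> carrier AutT"
  shows "first_descendants (pair u v) = {u, v}"
  using assms by (auto simp: first_descendants_def pair_eq_iff pair_neq_pair_swap)

lemma first_descendants_pair_swap:
  assumes "u \<in> carrier AutT" "v \<in> carrier AutT"
  shows "first_descendants (pair u v \<circ> swap) = {u \<circ> v}"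
  using assms
  by (auto simp: first_descendants_def pair_swap_eq_iff pair_neq_pair_swap[symmetric])

lemma gen_recursion:
  "gen r x 1 = pair id (gen r x r) \<circ> swap"
  "2 \<le> i \<Longrightarrow> \<not> x i \<Longrightarrow> gen r x i = pair (gen r x (i - 1)) id"
  "2 \<le> i \<Longrightarrow> x i \<Longrightarrow> gen r x i = pair id (gen r x (i - 1))"
proof -
  show "gen r x 1 = pair id (gen r x r) \<circ> swap"
  proof
    fix t show "gen r x 1 t = (pair id (gen r x r) \<circ> swap) t" by (cases t) auto
  qed
  show "gen r x i = pair (gen r x (i - 1)) id" if "2 \<le> i" "\<not> x i"
  proof
    fix t show "gen r x i t = pair (gen r x (i - 1)) id t" using that by (cases t) auto
  qed
  show "gen r x i = pair id (gen r x (i - 1))" if "2 \<le> i" "x i"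
  proof
    fix t show "gen r x i t = pair id (gen r x (i - 1)) t" using that by (cases t) auto
  qed
qed

lemma gen_unique:
  assumes b1: "b 1 = pair id (b r) \<circ> swap"
    and b0: "\<And>i. i \<in> {2..r} \<Longrightarrow> \<not> x i \<Longrightarrow> b i = pair (b (i - 1)) id"
    and bx: "\<And>i. i \<in> {2..r} \<Longrightarrow> x i \<Longrightarrow> b i = pair id (b (i - 1))"
    and i: "i \<in> {1..r}"
  shows "b i = gen r x i"
proof
  fix t show "b i t = gen r x i t"
    using i
  proof (induction t arbitrary: i)
    case Nil
    consider "i = 1" | "i \<in> {2..r}" using Nil by fastforce
    then show ?case using b1 b0 bx by cases (metis comp_apply pair.simps(1) swap.simps(1) gen.simps(1))+
  next
    case (Cons d t)
    consider "i = 1" | "i \<in> {2..r}" using Cons.prems by fastforce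
    then show ?case
    proof cases
      case 1
      have "b i (d # t) = pair id (b r) (swap (d # t))" using 1 b1 by (metis comp_apply)
      then show ?thesis using 1 Cons by auto
    next
      case 2
      then have "b (i - 1) t = gen r x (i - 1) t" by (intro Cons.IH) auto
      then show ?thesis using 2 b0[OF 2] bx[OF 2] by (cases "x i") auto
    qed
  qed
qed

lemma gen_cong:
  assumes "\<And>i. i \<in> {2..r} \<Longrightarrow> x i = y i" and "i \<in> {1..r}"
  shows "gen r x i = gen r y i"
  using gen_recursion assms by (intro gen_unique) (auto simp del: One_nat_def)

lemma gen_in_AutT: "gen r x i \<in> carrier AutT"
  unfolding AutT_iff
proof (intro conjI allI)
  have "s = t" if "gen r x i s = gen r x i t" for s t
    using that
  proof (induction s arbitrary: i t)
    case Nil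
    then show ?case by (cases t) (auto split: if_splits)
  next
    case (Cons d s)
    then show ?case by (cases t) (auto split: if_splits)
  qed
  moreover have "\<exists>s. y = gen r x i s" for y
  proof (induction y arbitrary: i)
    case Nil
    have "[] = gen r x i []" by simp
    then show ?case by blast
  next
    case (Cons d y)
    obtain s s' where s: "y = gen r x r s" "y = gen r x (i - 1) s'" using Cons by blast
    have "d # y = gen r x i (if i \<le> 1 then (if d then False # s else True # y)
                             else if d = x i then d # s' else d # y)"
      using s by auto
    then show ?case by blast
  qed
  ultimately show "bij (gen r x i)" by (auto simp: bij_def inj_def surj_def)
  show "gen r x i [] = []" by simp
  show "\<exists>e. gen r x i (s @ [d]) = gen r x i s @ [e]" for s d
    by (induction s arbitrary: i) auto
qed

end

theory Submission
  imports Defs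
begin

text \<open>
  Reading a word in the generators and following descendants, the word length never grows, because
  the two components of a pair share the letters between them. Hence along a cycle of descendants a
  shortest word keeps all its letters: every step has the form \<open>(w', 1)\<close> or
  \<open>(1, w')\<close>, or it is \<open>(u, v) \<sigma>\<close> with \<open>w' = u v\<close>. In each
  step the exponent sums of the generators are shifted cyclically, and \<open>\<sigma>\<close> occurs iff
  the exponent sum of \<open>b\<^sub>1\<close> is odd. The resulting sequence \<open>f\<close> of parities
  is thus \<open>r\<close>-periodic, and it determines the conjugacy class of \<open>w\<close> in
  \<open>W\<close>, because a conjugator can be built level by level. Conversely, every
  \<open>r\<close>-periodic parity sequence is realised by a product of distinct generators of
  \<open>\<Gamma>\<^bsub>(0,\<dots>,0)\<^esub>\<close>: there, descending shifts all indices
  cyclically and keeps the order of the factors.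
\<close>

section \<open>Arithmetic in the automorphism group\<close>

lemma comp_in_AutT: "u \<in> carrier AutT \<Longrightarrow> v \<in> carrier AutT \<Longrightarrow> u \<circ> v \<in> carrier AutT"
  using monoid.m_closed[OF group.is_monoid[OF group_AutT], of u v] by simp

lemma id_in_AutT: "id \<in> carrier AutT"
  using monoid.one_closed[OF group.is_monoid[OF group_AutT]] by simp

lemma inv_in_AutT: "u \<in> carrier AutT \<Longrightarrow> inv\<^bsub>AutT\<^esub> u \<in> carrier AutT"
  by (rule group.inv_closed[OF group_AutT])

lemma inv_AutT_comp:
  assumes "u \<in> carrier AutT"
  shows "inv\<^bsub>AutT\<^esub> u \<circ> u = id" "u \<circ> inv\<^bsub>AutT\<^esub> u = id"
  using group.l_inv[OF group_AutT assms] group.r_inv[OF group_AutT assms] by simp_all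

lemma inv_AutT_eqI:
  assumes "v \<circ> u = id" "u \<in> carrier AutT" "v \<in> carrier AutT"
  shows "inv\<^bsub>AutT\<^esub> u = v"
  using group.inv_equality[OF group_AutT, of v u] assms by simp

lemma AutT_length: "u \<in> carrier AutT \<Longrightarrow> length (u t) = length t"
proof (induction t rule: rev_induct)
  case Nil
  then show ?case by (simp add: AutT_iff)
next
  case (snoc d t)
  then show ?case using AutT_snoc[of u t d] by auto
qed

lemma pair_id_id [simp]: "pair id id = id"
proof
  show "pair id id t = id t" for t by (cases t) auto
qed

lemma pair_comp_pair: "pair u v \<circ> pair u' v' = pair (u \<circ> u') (v \<circ> v')"
proof
  show "(pair u v \<circ> pair u' v') t = pair (u \<circ> u') (v \<circ> v') t" for t by (cases t) auto
qed

lemma swap_comp_swap: "swap \<circ> swap = id"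
  by auto

lemma swap_comp_pair: "swap \<circ> pair u v = pair v u \<circ> swap"
proof
  show "(swap \<circ> pair u v) t = (pair v u \<circ> swap) t" for t by (cases t) auto
qed

lemma pair_swap_comp_pair: "(pair u v \<circ> swap) \<circ> pair u' v' = pair (u \<circ> v') (v \<circ> u') \<circ> swap"
proof -
  have "(pair u v \<circ> swap) \<circ> pair u' v' = pair u v \<circ> (swap \<circ> pair u' v')" by (simp only: o_assoc)
  then show ?thesis by (simp only: swap_comp_pair o_assoc pair_comp_pair)
qed

lemma pair_comp_pair_swap: "pair u v \<circ> (pair u' v' \<circ> swap) = pair (u \<circ> u') (v \<circ> v') \<circ> swap"
  by (simp only: o_assoc pair_comp_pair)

lemma pair_swap_comp_pair_swap:
  "(pair u v \<circ> swap) \<circ> (pair u' v' \<circ> swap) = pair (u \<circ> v') (v \<circ> u')"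
proof -
  have "(pair u v \<circ> swap) \<circ> (pair u' v' \<circ> swap) = ((pair u v \<circ> swap) \<circ> pair u' v') \<circ> swap"
    by (simp only: o_assoc)
  also have "\<dots> = pair (u \<circ> v') (v \<circ> u') \<circ> (swap \<circ> swap)"
    by (simp only: pair_swap_comp_pair o_assoc)
  finally show ?thesis by (simp only: swap_comp_swap comp_id)
qed

lemma inv_AutT_id: "inv\<^bsub>AutT\<^esub> id = id"
  by (rule inv_AutT_eqI) (simp_all add: id_in_AutT)

lemma inv_AutT_pair:
  assumes "u \<in> carrier AutT" "v \<in> carrier AutT"
  shows "inv\<^bsub>AutT\<^esub> (pair u v) = pair (inv\<^bsub>AutT\<^esub> u) (inv\<^bsub>AutT\<^esub> v)"
  using assms
  by (intro inv_AutT_eqI) (simp_all add: pair_comp_pair inv_AutT_comp pair_in_AutT inv_in_AutT)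

lemma inv_AutT_pair_swap:
  assumes "u \<in> carrier AutT" "v \<in> carrier AutT"
  shows "inv\<^bsub>AutT\<^esub> (pair u v \<circ> swap) = pair (inv\<^bsub>AutT\<^esub> v) (inv\<^bsub>AutT\<^esub> u) \<circ> swap"
proof (rule inv_AutT_eqI)
  show "pair (inv\<^bsub>AutT\<^esub> v) (inv\<^bsub>AutT\<^esub> u) \<circ> swap \<circ> (pair u v \<circ> swap) = id"
    unfolding pair_swap_comp_pair_swap using assms by (simp only: inv_AutT_comp pair_id_id)
qed (use assms in \<open>auto intro!: comp_in_AutT pair_in_AutT inv_in_AutT swap_in_AutT\<close>)

lemma nth_descendants_Suc_left:
  "nth_descendants (Suc n) w = (\<Union>v\<in>first_descendants w. nth_descendants n v)"
  by (induction n) auto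

lemma Desc_closed:
  assumes "w \<in> X" and "\<And>u. u \<in> X \<Longrightarrow> first_descendants u \<subseteq> X"
  shows "Desc w \<subseteq> X"
proof -
  have "nth_descendants n w \<subseteq> X" for n
    using assms by (induction n) auto
  then show ?thesis by (auto simp: Desc_def)
qed

section \<open>Conjugacy classes from swap patterns\<close>

text \<open>The solution of \<open>normal_form f = pair id (normal_form (f \<circ> Suc)) \<circ>
  swap\<close> if \<open>f 0\<close>, and \<open>= pair (normal_form (f \<circ> Suc)) id\<close>
  otherwise; it represents the conjugacy class belonging to the pattern \<open>f\<close>.\<close>

fun normal_form :: "(nat \<Rightarrow> bool) \<Rightarrow> vertex \<Rightarrow> vertex" where
  "normal_form f [] = []"
| "normal_form f (d # t) =
     (if f 0 then (if d then False # t else True # normal_form (f \<circ> Suc) t)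
      else (if d then True # t else False # normal_form (f \<circ> Suc) t))"

text \<open>On nonempty vertices this is \<open>h s \<circ> pair g g\<close> with \<open>g\<close>
  the tower of the next state. The same \<open>g\<close> on both sides commutes with
  \<open>swap\<close>, so conjugating deeper levels keeps the shape
  \<open>pair id w' \<circ> swap\<close>.\<close>

primrec tower :: "('s \<Rightarrow> vertex \<Rightarrow> vertex) \<Rightarrow> ('s \<Rightarrow> 's) \<Rightarrow> 's \<Rightarrow> vertex \<Rightarrow> vertex" where
  "tower h next_state s [] = []"
| "tower h next_state s (d # t) = h s (d # tower h next_state (next_state s) t)"

text \<open>
  The states are restricted to an invariant set \<open>P\<close>, since \<open>h\<close> will come from a
  choice that is only meaningful there.
\<close>

lemma tower_in_AutT:
  assumes h: "\<And>s. P s \<Longrightarrow> h s \<in> carrier AutT" and P: "\<And>s. P s \<Longrightarrow> P (n s)" and s: "P s"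
  shows "tower h n s \<in> carrier AutT"
  unfolding AutT_iff
proof (intro conjI allI)
  have hinj: "h s a = h s b \<Longrightarrow> a = b" if "P s" for s a b
    using h[OF that] by (metis AutT_iff bij_is_inj injD)
  have hsurj: "\<exists>a. h s a = b" if "P s" for s b
    using h[OF that] by (metis AutT_iff bij_pointE)
  have len: "length (tower h n s t) = length t" if "P s" for s t
    using that by (induction t arbitrary: s) (auto simp: AutT_length[OF h] P)
  have "t = t'" if "tower h n s t = tower h n s t'" "P s" for t t'
    using that
  proof (induction t arbitrary: s t')
    case Nil
    then show ?case using len[of s t'] by auto
  next
    case (Cons d t)
    then obtain d' t'' where t': "t' = d' # t''"
      using len[of s "d # t"] len[of s t'] by (cases t') auto
    have "d # tower h n (n s) t = d' # tower h n (n s) t''"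
      using Cons.prems t' hinj by auto
    then show ?case using t' Cons.IH[of "n s" t''] P[OF Cons.prems(2)] by simp
  qed
  then have "inj (tower h n s)" using s by (auto intro: injI)
  \<comment> \<open>Induction on the length, because \<open>h s\<close> may change every letter of a
    vertex but not its length.\<close>
  moreover have "\<exists>t. tower h n s t = y" if "length y = k" "P s" for y k
    using that
  proof (induction k arbitrary: y s)
    case 0
    have "tower h n s [] = y" using 0 by simp
    then show ?case by blast
  next
    case (Suc k)
    obtain a where a: "h s a = y" using hsurj Suc.prems by blast
    have "length a = Suc k" using AutT_length[OF h[OF Suc.prems(2)], of a] a Suc.prems by simp
    then obtain d z where z: "a = d # z" "length z = k" by (cases a) auto
    obtain t where "tower h n (n s) t = z" using Suc.IH[OF z(2) P[OF Suc.prems(2)]] by blast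
    then have "tower h n s (d # t) = y" using a z by simp
    then show ?case by blast
  qed
  ultimately show "bij (tower h n s)" using s by (auto simp: bij_def surj_def) metis
  show "tower h n s [] = []" by simp
  show "\<exists>e. tower h n s (t @ [d]) = tower h n s t @ [e]" for t d
    using s
  proof (induction t arbitrary: s)
    case Nil
    have "length (h s [d]) = 1" using AutT_length[OF h[OF Nil], of "[d]"] by simp
    then obtain e where "h s [d] = [e]" by (cases "h s [d]") auto
    then show ?case by auto
  next
    case (Cons a t)
    obtain e where "tower h n (n s) (t @ [d]) = tower h n (n s) t @ [e]"
      using Cons.IH[OF P[OF Cons.prems]] by blast
    then show ?case
      using AutT_snoc[OF h[OF Cons.prems], of "a # tower h n (n s) t" e] by auto
  qed
qed

text \<open>The conjugators of the single steps are assembled into one tower. The result depends on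
  \<open>f\<close> alone, so elements with different invariants \<open>R\<close> can be compared
  through it.\<close>

lemma conjugate_normal_form:
  assumes step: "\<And>f w. R f w \<Longrightarrow>
      \<exists>h\<in>carrier AutT. \<exists>w'. R (f \<circ> Suc) w' \<and>
        w \<circ> h = h \<circ> (if f 0 then pair id w' \<circ> swap else pair w' id)"
    and R: "R f w"
  shows "\<exists>g\<in>carrier AutT. w \<circ> g = g \<circ> normal_form f"
proof -
  define P where "P = (\<lambda>(f, w). R f w)"
  \<comment> \<open>The implication stands inside the existential so that the choice is total, with
    arbitrary values outside \<open>P\<close>.\<close>
  have "\<forall>s. \<exists>hw. P s \<longrightarrow> fst hw \<in> carrier AutT \<and> P (fst s \<circ> Suc, snd hw) \<and>
      snd s \<circ> fst hw = fst hw \<circ> (if fst s 0 then pair id (snd hw) \<circ> swap else pair (snd hw) id)"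
    using step by (force simp: P_def)
  then obtain H where H: "\<And>s. P s \<Longrightarrow> fst (H s) \<in> carrier AutT"
      "\<And>s. P s \<Longrightarrow> P (fst s \<circ> Suc, snd (H s))"
      "\<And>s. P s \<Longrightarrow> snd s \<circ> fst (H s) =
         fst (H s) \<circ> (if fst s 0 then pair id (snd (H s)) \<circ> swap else pair (snd (H s)) id)"
    by metis
  define h where "h s = fst (H s)" for s
  define n where "n s = (fst s \<circ> Suc, snd (H s))" for s
  have "tower h n s \<in> carrier AutT" if "P s" for s
    by (rule tower_in_AutT[of P]) (use that H in \<open>auto simp: h_def n_def\<close>)
  moreover have "snd s (tower h n s t) = tower h n s (normal_form (fst s) t)" if "P s" for s t
    using that
  proof (induction t arbitrary: s)
    case Nil
    have "snd s (h s []) = h s []"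
      using fun_cong[OF H(3)[OF Nil], of "[]"] by (auto simp: h_def)
    moreover have "h s [] = []" using H(1)[OF Nil] by (simp add: h_def AutT_iff)
    ultimately show ?case by simp
  next
    case (Cons d t)
    have IH: "snd (H s) (tower h n (n s) t) = tower h n (n s) (normal_form (fst s \<circ> Suc) t)"
      using Cons.IH[of "n s"] H(2)[OF Cons.prems] unfolding n_def fst_conv snd_conv by blast
    show ?case
      using fun_cong[OF H(3)[OF Cons.prems, folded h_def], of "d # tower h n (n s) t"] IH
      by auto
  qed
  ultimately show ?thesis
    using R by (intro bexI[of _ "tower h n (f, w)"]) (fastforce simp: P_def)+
qed

section \<open>Words in the generators\<close>

text \<open>Otherwise simp turns composites into lambda abstractions over vertices, which match no rule.\<close>

declare comp_apply [simp del] id_apply [simp del]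

definition letter :: "nat \<Rightarrow> (nat \<Rightarrow> bool) \<Rightarrow> nat \<Rightarrow> (vertex \<Rightarrow> vertex) \<Rightarrow> bool" where
  "letter r x i a \<longleftrightarrow> a = gen r x i \<or> a = inv\<^bsub>AutT\<^esub> gen r x i"

lemma letter_in_AutT: "letter r x i a \<Longrightarrow> a \<in> carrier AutT"
  by (auto simp: letter_def gen_in_AutT inv_in_AutT)

text \<open>The two cases are the two signs: inversion moves the nontrivial component to the other
  side.\<close>

lemma letter_1_cases:
  assumes "letter r x 1 a"
  obtains a' where "letter r x r a'" "a = pair id a' \<circ> swap"
  | a' where "letter r x r a'" "a = pair a' id \<circ> swap"
  using assms that unfolding letter_def gen_recursion(1)
  by (auto simp only: inv_AutT_pair_swap[OF id_in_AutT gen_in_AutT] inv_AutT_id)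

text \<open>Here the side is decided by \<open>x i\<close>, whatever the sign. The case distinction
  forgets which side it is, so the argument on words is uniform in \<open>x\<close>.\<close>

lemma letter_cases:
  assumes "letter r x i a" "2 \<le> i"
  obtains a' where "letter r x (i - 1) a'" "a = pair a' id"
  | a' where "letter r x (i - 1) a'" "a = pair id a'"
proof (cases "x i")
  case True
  then show ?thesis
    using assms that gen_recursion(3)[of i x r, OF assms(2) True] unfolding letter_def
    by (metis inv_AutT_pair[OF id_in_AutT gen_in_AutT] inv_AutT_id)
next
  case False
  then show ?thesis
    using assms that gen_recursion(2)[of i x r, OF assms(2) False] unfolding letter_def
    by (metis inv_AutT_pair[OF gen_in_AutT id_in_AutT] inv_AutT_id)
qed

text \<open>
  \<open>rep r x n f w\<close>: \<open>w\<close> is a product of \<open>n\<close> letters, and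
  \<open>f k\<close> is the parity of the number of letters with index \<open>1 + k mod r\<close>, so
  that passing to descendants turns \<open>f\<close> into \<open>f \<circ> Suc\<close>.
\<close>

inductive rep :: "nat \<Rightarrow> (nat \<Rightarrow> bool) \<Rightarrow> nat \<Rightarrow> (nat \<Rightarrow> bool) \<Rightarrow> (vertex \<Rightarrow> vertex) \<Rightarrow> bool"
  for r x where
  rep_id: "rep r x 0 (\<lambda>_. False) id"
| rep_letter: "i \<in> {1..r} \<Longrightarrow> letter r x i a \<Longrightarrow> rep r x n f w \<Longrightarrow>
    rep r x (Suc n) (\<lambda>k. (Suc (k mod r) = i) \<noteq> f k) (a \<circ> w)"

lemma rep_in_AutT: "rep r x n f w \<Longrightarrow> w \<in> carrier AutT"
  by (induction rule: rep.induct) (auto intro: id_in_AutT comp_in_AutT letter_in_AutT)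

lemma rep_periodic: "rep r x n f w \<Longrightarrow> f (k mod r) = f k"
  by (induction rule: rep.induct) auto

lemma rep_0: "rep r x 0 f w \<Longrightarrow> f = (\<lambda>_. False) \<and> w = id"
  by (erule rep.cases) auto

lemma rep_comp:
  "rep r x n f u \<Longrightarrow> rep r x m g v \<Longrightarrow> rep r x (n + m) (\<lambda>k. f k \<noteq> g k) (u \<circ> v)"
proof (induction rule: rep.induct)
  case rep_id
  then show ?case by simp
next
  case (rep_letter i a n f w)
  have "(\<lambda>k. (Suc (k mod r) = i) \<noteq> (f k \<noteq> g k)) = (\<lambda>k. ((Suc (k mod r) = i) \<noteq> f k) \<noteq> g k)"
    by auto
  then show ?case
    using rep.rep_letter[OF rep_letter.hyps(1,2) rep_letter.IH[OF rep_letter.prems]]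
    by (simp add: o_assoc)
qed

lemma rep_letter_single:
  assumes "i \<in> {1..r}" "letter r x i a"
  shows "rep r x 1 (\<lambda>k. Suc (k mod r) = i) a"
  using rep_letter[OF assms rep_id] by simp

lemma Gamma_rep:
  assumes "w \<in> Gamma r x"
  obtains n f where "rep r x n f w"
proof -
  have "\<exists>n f. rep r x n f w"
    using assms unfolding Gamma_def
  proof (induction rule: generate.induct)
    case one
    then show ?case using rep_id by auto
  next
    case (incl h)
    then show ?case using rep_letter_single[of _ r x h] unfolding letter_def by blast
  next
    case (inv h)
    then show ?case
      using rep_letter_single[of _ r x "inv\<^bsub>AutT\<^esub> h"] unfolding letter_def by blast
  next
    case (eng h1 h2)
    then show ?case using rep_comp by (metis AutT_simps(1))
  qed
  then show ?thesis using that by blast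
qed

text \<open>Descending lowers the index of a letter by one, cyclically; position \<open>k\<close> of
  the shifted parity sequence must count exactly these letters.\<close>

lemma Suc_mod_shift:
  assumes "i \<in> {1..r}"
  shows "Suc (Suc k mod r) = i \<longleftrightarrow> Suc (k mod r) = (if i \<le> 1 then r else i - 1)"
  using assms mod_less_divisor[of r k] by (auto simp: mod_Suc)

text \<open>Every letter puts exactly one letter, with cyclically lowered index, into one of the two
  components. Hence lengths add up and parities shift; only letters of index 1 contribute a
  \<open>swap\<close>.\<close>

lemma rep_decompose:
  assumes "rep r x n f w"
  obtains u v m1 m2 f1 f2 where "rep r x m1 f1 u" "rep r x m2 f2 v" "m1 + m2 = n"
    "f \<circ> Suc = (\<lambda>k. f1 k \<noteq> f2 k)" "w = (if f 0 then pair u v \<circ> swap else pair u v)"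
proof -
  have "\<exists>u v m1 m2 f1 f2. rep r x m1 f1 u \<and> rep r x m2 f2 v \<and> m1 + m2 = n \<and>
    f \<circ> Suc = (\<lambda>k. f1 k \<noteq> f2 k) \<and> w = (if f 0 then pair u v \<circ> swap else pair u v)"
    using assms
  proof (induction rule: rep.induct)
    case rep_id
    show ?case
      using rep.rep_id[of r x]
      by (intro exI[of _ id] exI[of _ "0::nat"] exI[of _ "\<lambda>_. False"]) (auto simp: comp_def)
  next
    case (rep_letter i a n f w)
    then obtain u v m1 m2 f1 f2 where uv: "rep r x m1 f1 u" "rep r x m2 f2 v" "m1 + m2 = n"
      "f \<circ> Suc = (\<lambda>k. f1 k \<noteq> f2 k)" "w = (if f 0 then pair u v \<circ> swap else pair u v)"
      by blast
    define j where "j = (if i \<le> 1 then r else i - 1)"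
    have j: "j \<in> {1..r}" using rep_letter.hyps(1) by (auto simp: j_def)
    have f_Suc: "f (Suc k) \<longleftrightarrow> f1 k \<noteq> f2 k" for k using fun_cong[OF uv(4), of k] by (simp add: comp_apply)
    define b where "b = (\<lambda>k. Suc (k mod r) = j)"
    have shift: "(\<lambda>k. (Suc (k mod r) = i) \<noteq> f k) \<circ> Suc = (\<lambda>k. b k \<noteq> (f1 k \<noteq> f2 k))"
      using Suc_mod_shift[OF rep_letter.hyps(1)] f_Suc by (auto simp: fun_eq_iff comp_apply j_def b_def)
    have U: "rep r x (Suc m1) (\<lambda>k. b k \<noteq> f1 k) (c \<circ> u)"
      and V: "rep r x (Suc m2) (\<lambda>k. b k \<noteq> f2 k) (c \<circ> v)" if "letter r x j c" for c
      using rep.rep_letter[OF j that] uv unfolding b_def by auto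
    have f0: "(Suc (0 mod r) = i) \<noteq> f 0 \<longleftrightarrow> (i = 1) \<noteq> f 0" by auto
    have close: ?case
      if "rep r x k1 g1 u'" "rep r x k2 g2 v'" "k1 + k2 = Suc n"
        "(\<lambda>k. b k \<noteq> (f1 k \<noteq> f2 k)) = (\<lambda>k. g1 k \<noteq> g2 k)"
        "a \<circ> w = (if (i = 1) \<noteq> f 0 then pair u' v' \<circ> swap else pair u' v')"
      for u' v' k1 k2 g1 g2
      using that unfolding shift f0 by blast
    show ?case
    proof (cases "i = 1")
      case True
      then have "letter r x 1 a" and j_eq: "j = r" using rep_letter.hyps by (auto simp: j_def)
      then show ?thesis
      proof (cases rule: letter_1_cases)
        case (1 c)
        then have "letter r x j c" by (simp add: j_eq)
        \<comment> \<open>The \<open>swap\<close> of the new letter exchanges the components: the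
          old \<open>v\<close> comes first, and \<open>c\<close> is put in front of the old
          \<open>u\<close>.\<close>
        show ?thesis
          by (rule close[OF uv(2) U[OF \<open>letter r x j c\<close>]])
             (use uv(3) 1 True in \<open>auto simp: uv(5) pair_swap_comp_pair_swap pair_swap_comp_pair\<close>)
      next
        case (2 c)
        then have "letter r x j c" by (simp add: j_eq)
        show ?thesis
          by (rule close[OF V[OF \<open>letter r x j c\<close>] uv(1)])
             (use uv(3) 2 True in \<open>auto simp: uv(5) pair_swap_comp_pair_swap pair_swap_comp_pair\<close>)
      qed
    next
      case False
      then have i: "2 \<le> i" and j_eq: "j = i - 1" using rep_letter.hyps by (auto simp: j_def)
      from rep_letter.hyps(2) i show ?thesis
      proof (cases rule: letter_cases)
        case (1 c)
        then have "letter r x j c" by (simp add: j_eq)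
        show ?thesis
          by (rule close[OF U[OF \<open>letter r x j c\<close>] uv(2)])
             (use uv(3) 1 False in \<open>auto simp: uv(5) pair_comp_pair_swap pair_comp_pair\<close>)
      next
        case (2 c)
        then have "letter r x j c" by (simp add: j_eq)
        show ?thesis
          by (rule close[OF uv(1) V[OF \<open>letter r x j c\<close>]])
             (use uv(3) 2 False in \<open>auto simp: uv(5) pair_comp_pair_swap pair_comp_pair\<close>)
      qed
    qed
  qed
  then show ?thesis using that by blast
qed

text \<open>The words of the two components have total length \<open>n\<close>, which bounds each of
  them and also their concatenation.\<close>

lemma rep_first_descendant:
  assumes "rep r x n f w" "w' \<in> first_descendants w"
  shows "\<exists>m\<le>n. \<exists>g. rep r x m g w'"
proof -
  obtain u v m1 m2 f1 f2 where uv: "rep r x m1 f1 u" "rep r x m2 f2 v" "m1 + m2 = n"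
    and "f \<circ> Suc = (\<lambda>k. f1 k \<noteq> f2 k)"
    and w: "w = (if f 0 then pair u v \<circ> swap else pair u v)"
    by (rule rep_decompose[OF assms(1)])
  have AutT: "u \<in> carrier AutT" "v \<in> carrier AutT" using uv rep_in_AutT by auto
  have "w' = u \<or> w' = v \<or> w' = u \<circ> v"
    using assms(2) w first_descendants_pair[OF AutT] first_descendants_pair_swap[OF AutT]
    by (auto split: if_splits)
  moreover have "m1 \<le> n" "m2 \<le> n" using uv(3) by auto
  ultimately show ?thesis using uv rep_comp[OF uv(1,2)] by blast
qed

lemma rep_nth_descendant:
  assumes "rep r x n f w" "w' \<in> nth_descendants k w"
  shows "\<exists>m\<le>n. \<exists>g. rep r x m g w'"
  using assms(2)
proof (induction k arbitrary: w')
  case 0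
  then show ?case using assms(1) by auto
next
  case (Suc k)
  then obtain v where "v \<in> nth_descendants k w" "w' \<in> first_descendants v" by auto
  then show ?case using Suc.IH rep_first_descendant by (meson order_trans)
qed

section \<open>Recurrent elements\<close>

text \<open>The pattern is read off a shortest word: such a word cannot lose letters on a cycle of
  descendants, whereas a longer one might.\<close>

definition recurrent :: "nat \<Rightarrow> (nat \<Rightarrow> bool) \<Rightarrow> (nat \<Rightarrow> bool) \<Rightarrow> (vertex \<Rightarrow> vertex) \<Rightarrow> bool" where
  "recurrent r x f w \<longleftrightarrow> w \<in> Desc w \<and>
     (\<exists>n. rep r x n f w \<and> (\<forall>m g. rep r x m g w \<longrightarrow> n \<le> m))"

lemma pair_conj_swap: "pair id v \<circ> swap = swap \<circ> pair v id"
  by (simp add: swap_comp_pair)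

text \<open>Conjugation collects both components in the second one, where the descendant
  \<open>u \<circ> v\<close> appears.\<close>

lemma pair_swap_conj:
  assumes "u \<in> carrier AutT"
  shows "(pair u v \<circ> swap) \<circ> pair id (inv\<^bsub>AutT\<^esub> u) =
    pair id (inv\<^bsub>AutT\<^esub> u) \<circ> (pair id (u \<circ> v) \<circ> swap)"
  by (simp only: pair_swap_comp_pair pair_comp_pair o_assoc inv_AutT_comp[OF assms] comp_id id_comp)

text \<open>Going on from \<open>w'\<close> back to \<open>w\<close> cannot lengthen words, so
  \<open>w'\<close> needs at least \<open>n\<close> letters. These are all the letters of the word
  for \<open>w\<close>, so if \<open>w\<close> fixes both subtrees, the other component is
  trivial.\<close>

lemma recurrent_step:
  assumes "recurrent r x f w"
  shows "\<exists>h\<in>carrier AutT. \<exists>w'. recurrent r x (f \<circ> Suc) w' \<and>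
    w \<circ> h = h \<circ> (if f 0 then pair id w' \<circ> swap else pair w' id)"
proof -
  obtain n where n: "rep r x n f w" and minimal: "\<And>m g. rep r x m g w \<Longrightarrow> n \<le> m"
    using assms by (auto simp: recurrent_def)
  obtain N where N: "w \<in> nth_descendants (Suc N) w"
    using assms by (auto simp: recurrent_def Desc_def Suc_le_eq gr0_conv_Suc)
  then obtain w' where w': "w' \<in> first_descendants w" "w \<in> nth_descendants N w'"
    unfolding nth_descendants_Suc_left by blast
  \<comment> \<open>\<open>N\<close> steps lead from \<open>w'\<close> to \<open>w\<close>, and one
    more leads back to \<open>w'\<close>.\<close>
  have desc: "w' \<in> Desc w'"
    using w' by (auto simp: Desc_def intro!: bexI[of _ "Suc N"])
  have minimal': "n \<le> m" if m: "rep r x m g w'" for m g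
    using rep_nth_descendant[OF m w'(2)] minimal by (meson order_trans)
  have recurrent: "recurrent r x (f \<circ> Suc) w'" if "rep r x n (f \<circ> Suc) w'"
    using that desc minimal' by (auto simp: recurrent_def)
  obtain u v m1 m2 f1 f2 where uv: "rep r x m1 f1 u" "rep r x m2 f2 v" "m1 + m2 = n"
    and f: "f \<circ> Suc = (\<lambda>k. f1 k \<noteq> f2 k)"
    and w: "w = (if f 0 then pair u v \<circ> swap else pair u v)"
    by (rule rep_decompose[OF n])
  have AutT: "u \<in> carrier AutT" "v \<in> carrier AutT" using uv rep_in_AutT by auto
  show ?thesis
  proof (cases "f 0")
    case True
    then have "w' = u \<circ> v" using w'(1) w first_descendants_pair_swap[OF AutT] by auto
    moreover from this have "recurrent r x (f \<circ> Suc) w'"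
      using rep_comp[OF uv(1,2)] uv(3) f recurrent by simp
    ultimately show ?thesis
      using True w pair_swap_conj[OF AutT(1), of v]
      by (intro bexI[of _ "pair id (inv\<^bsub>AutT\<^esub> u)"] exI[of _ w'])
         (auto simp: AutT pair_in_AutT id_in_AutT inv_in_AutT)
  next
    case False
    then have "w' = u \<or> w' = v" using w'(1) w first_descendants_pair[OF AutT] by auto
    then show ?thesis
    proof
      assume "w' = u"
      then have "m2 = 0" using minimal' uv by fastforce
      then have v: "v = id" "f2 = (\<lambda>_. False)" using rep_0 uv(2) by auto
      have "recurrent r x (f \<circ> Suc) w'"
        using uv \<open>m2 = 0\<close> v f recurrent \<open>w' = u\<close> by simp
      then show ?thesis
        using False w v \<open>w' = u\<close> by (intro bexI[of _ id] exI[of _ u]) (auto simp: id_in_AutT)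
    next
      assume "w' = v"
      then have "m1 = 0" using minimal' uv by fastforce
      then have u: "u = id" "f1 = (\<lambda>_. False)" using rep_0 uv(1) by auto
      have "recurrent r x (f \<circ> Suc) w'"
        using uv \<open>m1 = 0\<close> u f recurrent \<open>w' = v\<close> by simp
      \<comment> \<open>Here \<open>w = pair id v\<close>, and \<open>swap\<close> brings the
        nontrivial component to the first place.\<close>
      then show ?thesis
        using False w u \<open>w' = v\<close> pair_conj_swap[of v]
        by (intro bexI[of _ swap] exI[of _ v]) (auto simp: swap_in_AutT)
    qed
  qed
qed

lemma Phi_irreducible_recurrent:
  assumes "w \<in> Gamma r x" "Phi_irreducible w"
  obtains f where "recurrent r x f w"
proof -
  define P where "P n \<longleftrightarrow> (\<exists>f. rep r x n f w)" for n
  have "\<exists>n. P n" using Gamma_rep[OF assms(1)] by (metis P_def)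
  then have "P (Least P)" by (rule LeastI_ex)
  then obtain f where "rep r x (Least P) f w" by (auto simp: P_def)
  moreover have "Least P \<le> m" if "rep r x m g w" for m g
    using that by (intro Least_le) (auto simp: P_def)
  moreover have "w \<in> Desc w" using assms(2) by (simp add: Phi_irreducible_def)
  ultimately have "recurrent r x f w" unfolding recurrent_def by blast
  then show ?thesis using that by blast
qed

section \<open>Products of distinct generators\<close>

abbreviation gen0 :: "nat \<Rightarrow> nat \<Rightarrow> vertex \<Rightarrow> vertex" where
  "gen0 r \<equiv> gen r (\<lambda>_. False)"

primrec gen_prod :: "nat \<Rightarrow> nat list \<Rightarrow> vertex \<Rightarrow> vertex" where
  "gen_prod r [] = id"
| "gen_prod r (i # l) = gen0 r i \<circ> gen_prod r l"

definition cpred :: "nat \<Rightarrow> nat \<Rightarrow> nat" where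
  "cpred r i = (if i \<le> 1 then r else i - 1)"

text \<open>Distinctness makes this set finite and allows at most one factor with a
  \<open>swap\<close> in a product.\<close>

definition index_lists :: "nat \<Rightarrow> nat list set" where
  "index_lists r = {l. distinct l \<and> set l \<subseteq> {1..r}}"

lemma gen_prod_append: "gen_prod r (l @ m) = gen_prod r l \<circ> gen_prod r m"
  by (induction l) (auto simp: o_assoc)

lemma gen_prod_in_AutT: "gen_prod r l \<in> carrier AutT"
  by (induction l) (auto intro: id_in_AutT comp_in_AutT gen_in_AutT)

lemma gen_prod_in_Gamma: "set l \<subseteq> {1..r} \<Longrightarrow> gen_prod r l \<in> Gamma r (\<lambda>_. False)"
proof (induction l)
  case Nil
  then show ?case using generate.one[of AutT] by (simp add: Gamma_def)
next
  case (Cons i l)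
  then show ?case
    using generate.eng[of "gen0 r i" AutT _ "gen_prod r l"] generate.incl[of "gen0 r i" _ AutT]
    by (auto simp: Gamma_def)
qed

lemma gen_prod_no_1:
  "set l \<subseteq> {2..r} \<Longrightarrow> gen_prod r l = pair (gen_prod r (map (cpred r) l)) id"
proof (induction l)
  case Nil
  then show ?case by simp
next
  case (Cons i l)
  then show ?case
    using gen_recursion(2)[of i "\<lambda>_. False" r] by (simp add: pair_comp_pair cpred_def)
qed

text \<open>All other generators act in the first component; those of \<open>q\<close> cross the
  \<open>swap\<close> and end up in the second. Multiplying the components therefore restores the
  original order of the factors.\<close>

lemma gen_prod_1:
  assumes "set p \<subseteq> {2..r}" "set q \<subseteq> {2..r}"
  shows "gen_prod r (p @ 1 # q) =
    pair (gen_prod r (map (cpred r) p)) (gen_prod r (map (cpred r) (1 # q))) \<circ> swap"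
proof -
  have "gen_prod r (p @ 1 # q) = pair (gen_prod r (map (cpred r) p)) id \<circ>
      ((pair id (gen0 r r) \<circ> swap) \<circ> pair (gen_prod r (map (cpred r) q)) id)"
    using assms by (simp add: gen_prod_append gen_prod_no_1 gen_recursion(1)[unfolded One_nat_def])
  also have "\<dots> = pair (gen_prod r (map (cpred r) p)) (gen_prod r (map (cpred r) (1 # q))) \<circ> swap"
    unfolding pair_swap_comp_pair pair_comp_pair_swap by (simp add: cpred_def)
  finally show ?thesis .
qed

lemma cpred_range: "i \<in> {1..r} \<Longrightarrow> cpred r i \<in> {1..r}"
  by (auto simp: cpred_def)

lemma map_cpred_index_lists:
  assumes "l \<in> index_lists r"
  shows "map (cpred r) l \<in> index_lists r"
proof -
  have "inj_on (cpred r) {1..r}" by (auto simp: inj_on_def cpred_def split: if_splits)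
  then have "inj_on (cpred r) (set l)" using assms inj_on_subset by (auto simp: index_lists_def)
  then show ?thesis
    using assms cpred_range by (auto simp: index_lists_def distinct_map simp del: atLeastAtMost_iff)
qed

lemma finite_index_lists: "finite (index_lists r)"
proof -
  have "length l \<le> r" if "l \<in> index_lists r" for l
    using that card_mono[of "{1..r}" "set l"] distinct_card[of l] by (auto simp: index_lists_def)
  then have "index_lists r \<subseteq> {l. set l \<subseteq> {1..r} \<and> length l \<le> r}" by (auto simp: index_lists_def)
  then show ?thesis using finite_lists_length_le[of "{1..r}" r] finite_subset by blast
qed

lemma gen_prod_cases:
  assumes "l \<in> index_lists r"
  obtains "1 \<notin> set l" "gen_prod r l = pair (gen_prod r (map (cpred r) l)) id"
  | u v where "1 \<in> set l" "u \<in> carrier AutT" "v \<in> carrier AutT"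
      "gen_prod r l = pair u v \<circ> swap" "gen_prod r (map (cpred r) l) = u \<circ> v"
proof (cases "1 \<in> set l")
  case False
  have "i \<in> {2..r}" if "i \<in> set l" for i
  proof -
    have "i \<noteq> 1" "i \<in> {1..r}" using that False assms by (auto simp: index_lists_def)
    then show ?thesis by auto
  qed
  then have "set l \<subseteq> {2..r}" by blast
  then show ?thesis using that(1) False gen_prod_no_1 by blast
next
  case True
  then obtain p q where l: "l = p @ 1 # q" by (meson split_list)
  have "i \<in> {2..r}" if "i \<in> set p \<union> set q" for i
  proof -
    have "i \<noteq> 1" "i \<in> {1..r}" using that l assms by (auto simp: index_lists_def)
    then show ?thesis by auto
  qed
  then have pq: "set p \<subseteq> {2..r}" "set q \<subseteq> {2..r}" by blast+
  have "gen_prod r (map (cpred r) l) =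
      gen_prod r (map (cpred r) p) \<circ> gen_prod r (map (cpred r) (1 # q))"
    unfolding l map_append by (simp only: gen_prod_append list.map)
  then show ?thesis
    using that(2)[OF True gen_prod_in_AutT gen_prod_in_AutT] gen_prod_1[OF pq] l by blast
qed

text \<open>Besides the product with shifted indices only the identity can occur, and that is the
  empty product.\<close>

lemma first_descendants_gen_prod:
  assumes "l \<in> index_lists r"
  shows "gen_prod r (map (cpred r) l) \<in> first_descendants (gen_prod r l)"
    "first_descendants (gen_prod r l) \<subseteq> gen_prod r ` index_lists r"
proof -
  have *: "id \<in> gen_prod r ` index_lists r"
    by (rule image_eqI[of _ _ "[]"]) (auto simp: index_lists_def)
  have **: "gen_prod r (map (cpred r) l) \<in> gen_prod r ` index_lists r"
    using map_cpred_index_lists[OF assms] by blast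
  from assms show "gen_prod r (map (cpred r) l) \<in> first_descendants (gen_prod r l)"
    by (cases rule: gen_prod_cases)
       (simp_all add: first_descendants_pair first_descendants_pair_swap gen_prod_in_AutT id_in_AutT)
  from assms show "first_descendants (gen_prod r l) \<subseteq> gen_prod r ` index_lists r"
    by (cases rule: gen_prod_cases)
       (use * ** in \<open>simp_all add: first_descendants_pair first_descendants_pair_swap
          gen_prod_in_AutT id_in_AutT\<close>)
qed

text \<open>From \<open>i\<close>, the first \<open>i\<close> steps go down to 1 and around to
  \<open>r\<close>; the other \<open>r - i\<close> steps go down from \<open>r\<close> to
  \<open>i\<close>.\<close>

lemma funpow_cpred:
  assumes "i \<in> {1..r}"
  shows "(cpred r ^^ r) i = i"
proof -
  have *: "(cpred r ^^ k) j = j - k" if "k < j" for j k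
    using that by (induction k) (auto simp: cpred_def comp_apply id_apply)
  obtain m where m: "i = Suc m" using assms by (cases i) auto
  have "(cpred r ^^ i) i = cpred r ((cpred r ^^ m) i)" by (simp add: m comp_apply)
  also have "\<dots> = r" using *[of m i] by (simp add: m cpred_def)
  finally have "(cpred r ^^ ((r - i) + i)) i = (cpred r ^^ (r - i)) r"
    unfolding funpow_add by (simp add: comp_apply)
  also have "\<dots> = i" using *[of "r - i" r] assms by simp
  finally show ?thesis using assms by simp
qed

text \<open>All descendants lie in the finite set of products over \<open>index_lists r\<close>, and
  after \<open>r\<close> shifts the list itself returns. As \<open>r > 0\<close>, this counts as a
  proper descent.\<close>

lemma Phi_irreducible_gen_prod:
  assumes "r > 0" "l \<in> index_lists r"
  shows "Phi_irreducible (gen_prod r l)"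
proof -
  have "Desc (gen_prod r l) \<subseteq> gen_prod r ` index_lists r"
    using assms first_descendants_gen_prod(2) by (intro Desc_closed) auto
  then have fin: "finite (Desc (gen_prod r l))"
    using finite_index_lists finite_subset by blast
  have "map (cpred r ^^ k) l \<in> index_lists r \<and>
      gen_prod r (map (cpred r ^^ k) l) \<in> nth_descendants k (gen_prod r l)" for k
  proof (induction k)
    case 0
    then show ?case using assms by (simp add: id_apply)
  next
    case (Suc k)
    then show ?case
      using map_cpred_index_lists[of "map (cpred r ^^ k) l" r]
        first_descendants_gen_prod(1)[of "map (cpred r ^^ k) l" r] by auto
  qed
  moreover have "map (cpred r ^^ r) l = l"
    using assms funpow_cpred by (intro map_idI) (auto simp: index_lists_def)
  ultimately have "gen_prod r l \<in> nth_descendants r (gen_prod r l)" by metis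
  then show ?thesis using fin assms by (auto simp: Phi_irreducible_def Desc_def Suc_le_eq)
qed

text \<open>For a list without repetitions the parity of the number of occurrences is just
  membership, so \<open>f\<close> is again a parity sequence.\<close>

definition gen_prod_pattern :: "nat \<Rightarrow> (nat \<Rightarrow> bool) \<Rightarrow> (vertex \<Rightarrow> vertex) \<Rightarrow> bool" where
  "gen_prod_pattern r f w \<longleftrightarrow>
     (\<exists>l\<in>index_lists r. w = gen_prod r l \<and> f = (\<lambda>k. Suc (k mod r) \<in> set l))"

lemma gen_prod_pattern_step:
  assumes "gen_prod_pattern r f w"
  shows "\<exists>h\<in>carrier AutT. \<exists>w'. gen_prod_pattern r (f \<circ> Suc) w' \<and>
    w \<circ> h = h \<circ> (if f 0 then pair id w' \<circ> swap else pair w' id)"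
proof -
  obtain l where l: "l \<in> index_lists r" and w: "w = gen_prod r l"
    and f: "f = (\<lambda>k. Suc (k mod r) \<in> set l)"
    using assms by (auto simp: gen_prod_pattern_def)
  let ?w' = "gen_prod r (map (cpred r) l)"
  have "Suc (Suc k mod r) \<in> set l \<longleftrightarrow> (\<exists>i\<in>set l. Suc (k mod r) = cpred r i)" for k
    using l Suc_mod_shift[of _ r k] unfolding index_lists_def cpred_def by blast
  then have "f \<circ> Suc = (\<lambda>k. Suc (k mod r) \<in> set (map (cpred r) l))"
    by (auto simp: f fun_eq_iff comp_apply)
  then have pattern: "gen_prod_pattern r (f \<circ> Suc) ?w'"
    using map_cpred_index_lists[OF l] by (auto simp: gen_prod_pattern_def)
  have f0: "f 0 \<longleftrightarrow> 1 \<in> set l" by (simp add: f)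
  from l show ?thesis
  proof (cases rule: gen_prod_cases)
    case 1
    then show ?thesis
      using pattern f0 w by (intro bexI[of _ id] exI[of _ ?w']) (auto simp: id_in_AutT)
  next
    case (2 u v)
    then show ?thesis
      using pattern f0 w pair_swap_conj[OF 2(2), of v]
      by (intro bexI[of _ "pair id (inv\<^bsub>AutT\<^esub> u)"] exI[of _ ?w'])
         (auto simp: pair_in_AutT id_in_AutT inv_in_AutT)
  qed
qed

theorem proposition4p18:
  fixes r :: nat and x :: "nat \<Rightarrow> bool" and w :: "vertex \<Rightarrow> vertex"
  assumes "r > 0"
    and "w \<in> Gamma r x"
    and "Phi_irreducible w"
  shows "\<exists>w'\<in>Gamma r (\<lambda>_. False). Phi_irreducible w' \<and>
           (\<exists>g\<in>carrier AutT. w = g \<otimes>\<^bsub>AutT\<^esub> w' \<otimes>\<^bsub>AutT\<^esub> inv\<^bsub>AutT\<^esub> g)"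
proof -
  obtain f where rec: "recurrent r x f w"
    using Phi_irreducible_recurrent assms(2,3) by blast
  then have periodic: "f (k mod r) = f k" for k
    using rep_periodic unfolding recurrent_def by blast
  \<comment> \<open>Position \<open>i - 1\<close> of \<open>f\<close> belongs to the generator of
    index \<open>i\<close>, so this product has the same pattern as \<open>w\<close>.\<close>
  define l where "l = filter (\<lambda>i. f (i - 1)) [1..<Suc r]"
  define w' where "w' = gen_prod r l"
  have l: "l \<in> index_lists r" by (auto simp: l_def index_lists_def)
  have "f k \<longleftrightarrow> Suc (k mod r) \<in> set l" for k
    using periodic[of k] mod_less_divisor[OF assms(1), of k] by (simp add: l_def del: upt_Suc)
  then have "f = (\<lambda>k. Suc (k mod r) \<in> set l)" by (simp add: fun_eq_iff)
  then have pattern: "gen_prod_pattern r f w'"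
    using l by (auto simp: gen_prod_pattern_def w'_def)
  \<comment> \<open>Both \<open>w\<close> and \<open>w'\<close> are conjugate to
    \<open>normal_form f\<close>; the conjugator sought is \<open>g1\<close> composed with the
    inverse of \<open>g2\<close>.\<close>
  obtain g1 where g1: "g1 \<in> carrier AutT" "w \<circ> g1 = g1 \<circ> normal_form f"
    using conjugate_normal_form[of "recurrent r x", OF recurrent_step rec] by blast
  obtain g2 where g2: "g2 \<in> carrier AutT" "w' \<circ> g2 = g2 \<circ> normal_form f"
    using conjugate_normal_form[of "gen_prod_pattern r", OF gen_prod_pattern_step pattern] by blast
  define h where "h = inv\<^bsub>AutT\<^esub> g2"
  have h: "h \<in> carrier AutT" "h \<circ> g2 = id" "g2 \<circ> h = id"
    using g2(1) by (auto simp: h_def inv_in_AutT inv_AutT_comp)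
  define g where "g = g1 \<circ> h"
  have g: "g \<in> carrier AutT" using g1 h by (simp add: g_def comp_in_AutT)
  have "normal_form f \<circ> h = h \<circ> w'"
  proof -
    have "normal_form f \<circ> h = h \<circ> (g2 \<circ> normal_form f) \<circ> h"
      by (simp only: o_assoc h(2) id_comp)
    also have "\<dots> = h \<circ> w' \<circ> (g2 \<circ> h)" by (simp only: g2(2)[symmetric] o_assoc)
    finally show ?thesis by (simp only: h(3) comp_id)
  qed
  then have "w \<circ> g = g \<circ> w'"
    unfolding g_def by (metis g1(2) comp_assoc)
  then have "w = g \<circ> w' \<circ> inv\<^bsub>AutT\<^esub> g"
    by (metis inv_AutT_comp(2)[OF g] comp_assoc comp_id)
  moreover have "w' \<in> Gamma r (\<lambda>_. False)"
    using gen_prod_in_Gamma l by (auto simp: w'_def index_lists_def)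
  ultimately show ?thesis
    using Phi_irreducible_gen_prod[OF assms(1) l] g by (auto simp: w'_def)
qed

end
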